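(* For any demand function $p$, an equilibrium (of the disclosure game without commitment, in which the buyer does not observe $y$) exists, and any equilibrium disclosure strategy $d^*$ has a threshold structure: $d^*(x,y)\in\{0,1\}$ and $$d^*(x,y)=1\iff (x-\bar x)\,y\ge 0,$$ for some $\bar x\in\mathcal X$ satisfying $\bar x=\mathbb E\left[x\,|\,(x-\bar x)y<0\right]$ if $\{(x,y)\in\mathcal X\times\mathcal Y:(x-\bar x)y<0\}\ne\varnothing$.
   Context: Let $\mathcal X=[x_{min},x_{max}]$ and $\mathcal Y=[y_{min},y_{max}]$ be nondegenerate compact intervals; $y_{min}$ may be negative. An object has a profitability $y\in\mathcal Y$ to a seller, with marginal cdf $F_Y$. Conditional on $y$, the seller observes a signal realization $x\in\mathcal X$ with cdf $F_{X|y}$; a signal realization is identified with the posterior mean of the object's value to the buyer that it induces, which does not depend on $y$. Standing assumptions: $F_Y$ has full support on $\mathcal Y$ and each $F_{X|y}$ has full support on $\mathcal X$; the joint distribution of $(x,y)$ has no mass points, in the sense that for every $a\in\mathcal X$ and measurable $\varphi:\mathcal X\to\mathbb R$ the event $\{(x-a)(y-\varphi(x))=0\}$ has probability zero. A demand function is a strictly increasing differentiable $p:\mathcal X\to[0,1]$; $p(\hat x)$ is the probability that the buyer purchases when the buyer's posterior mean is $\hat x$. The seller's payoff is $y$ if the object is sold and $0$ otherwise. Disclosure game without commitment: the seller observes $(x,y)$ and then chooses whether to disclose $x$ (profitability cannot be disclosed). If $x$ is disclosed, the buyer's posterior mean is $x$. If not, the buyer, who does not observe $y$, has a posterior mean $\hat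 x\in\mathcal X$. A (perfect Bayesian) equilibrium is a measurable disclosure strategy $d^*:(x,y)\mapsto d^*(x,y)\in[0,1]$ together with $\hat x\in\mathcal X$ such that (a) for every $(x,y)$, the seller's choice maximizes the expected payoff, which is $y\,p(x)$ from disclosing and $y\,p(\hat x)$ from not disclosing, and (b) $\hat x$ equals the conditional expectation of $x$ given non-disclosure under $d^*$ whenever non-disclosure has positive probability (and is an arbitrary element of $\mathcal X$ otherwise). Convention: when indifferent, the seller discloses. *)

theory Defs
  imports "HOL-Probability.Probability"
begin

definition full_support_on :: "real measure \<Rightarrow> real set \<Rightarrow> bool" where
  "full_support_on M S \<longleftrightarrow> (\<forall>U. open U \<and> U \<inter> S \<noteq> {} \<longrightarrow> emeasure M (U \<inter> S) > 0)"

text \<open>Law of \<open>(x, y)\<close>, signal first, for \<open>y\<close> drawn from \<open>FY\<close> and then \<open>x\<close> from the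
  conditional law \<open>FX y\<close>. Its space is the rectangle \<open>{xmin..xmax} \<times> {ymin..ymax}\<close>.\<close>

definition joint_law ::
  "real \<Rightarrow> real \<Rightarrow> real \<Rightarrow> real \<Rightarrow> real measure \<Rightarrow> (real \<Rightarrow> real measure) \<Rightarrow> (real \<times> real) measure" where
  "joint_law xmin xmax ymin ymax FY FX =
     FY \<bind> (\<lambda>y. FX y \<bind> (\<lambda>x.
       return (restrict_space borel {xmin..xmax} \<Otimes>\<^sub>M restrict_space borel {ymin..ymax}) (x, y)))"

text \<open>The cdfs \<open>F_Y\<close> and \<open>F_X|y\<close> are represented by the probability measures they induce;
  joint measurability makes \<open>FX\<close> a Markov kernel.\<close>

locale disclosure_environment =
  fixes xmin xmax ymin ymax :: real
    and FY :: "real measure" and FX :: "real \<Rightarrow> real measure"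
  assumes x_nondegenerate: "xmin < xmax"
    and y_nondegenerate: "ymin < ymax"
    and FY_prob: "FY \<in> space (prob_algebra (restrict_space borel {ymin..ymax}))"
    and FX_kernel: "FX \<in> restrict_space borel {ymin..ymax} \<rightarrow>\<^sub>M
                      prob_algebra (restrict_space borel {xmin..xmax})"
    and FY_full_support: "full_support_on FY {ymin..ymax}"
    and FX_full_support: "\<And>y. y \<in> {ymin..ymax} \<Longrightarrow> full_support_on (FX y) {xmin..xmax}"
    and no_mass_points:
      "\<And>a \<phi>. a \<in> {xmin..xmax} \<Longrightarrow> \<phi> \<in> borel_measurable (restrict_space borel {xmin..xmax}) \<Longrightarrow>
         measure (joint_law xmin xmax ymin ymax FY FX)
           {(x, y) \<in> {xmin..xmax} \<times> {ymin..ymax}. (x - a) * (y - \<phi> x) = 0} = 0"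

definition demand_function :: "real \<Rightarrow> real \<Rightarrow> (real \<Rightarrow> real) \<Rightarrow> bool" where
  "demand_function xmin xmax p \<longleftrightarrow>
     p \<in> {xmin..xmax} \<rightarrow> {0..1} \<and> strict_mono_on {xmin..xmax} p \<and> p differentiable_on {xmin..xmax}"

text \<open>Payoff of type \<open>(x, y)\<close> from disclosing with probability \<open>q\<close> when the buyer's posterior
  mean after non-disclosure is \<open>xhat\<close>.\<close>

definition seller_payoff :: "(real \<Rightarrow> real) \<Rightarrow> real \<Rightarrow> real \<Rightarrow> real \<Rightarrow> real \<Rightarrow> real" where
  "seller_payoff p xhat x y q = q * (y * p x) + (1 - q) * (y * p xhat)"

definition prob_nondisclosure :: "(real \<times> real) measure \<Rightarrow> (real \<times> real \<Rightarrow> real) \<Rightarrow> real" where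
  "prob_nondisclosure M d = (\<integral>z. 1 - d z \<partial>M)"

text \<open>\<open>E[x | non-disclosure]\<close> under a randomised strategy \<open>d\<close>, by Bayes' rule; only meaningful
  when non-disclosure has positive probability.\<close>

definition mean_nondisclosure :: "(real \<times> real) measure \<Rightarrow> (real \<times> real \<Rightarrow> real) \<Rightarrow> real" where
  "mean_nondisclosure M d = (\<integral>z. fst z * (1 - d z) \<partial>M) / prob_nondisclosure M d"

text \<open>\<open>d (x, y)\<close> is the probability of disclosing; the clause with \<open>y * p x = y * p xhat\<close> is the
  tie-breaking convention that an indifferent seller discloses.\<close>

definition disclosure_equilibrium ::
  "real \<Rightarrow> real \<Rightarrow> real \<Rightarrow> real \<Rightarrow> real measure \<Rightarrow> (real \<Rightarrow> real measure) \<Rightarrow> (real \<Rightarrow> real)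
    \<Rightarrow> (real \<times> real \<Rightarrow> real) \<Rightarrow> real \<Rightarrow> bool" where
  "disclosure_equilibrium xmin xmax ymin ymax FY FX p d xhat \<longleftrightarrow>
     (let M = joint_law xmin xmax ymin ymax FY FX in
      d \<in> borel_measurable M \<and>
      (\<forall>x\<in>{xmin..xmax}. \<forall>y\<in>{ymin..ymax}. d (x, y) \<in> {0..1}) \<and>
      xhat \<in> {xmin..xmax} \<and>
      (\<forall>x\<in>{xmin..xmax}. \<forall>y\<in>{ymin..ymax}.
         (\<forall>q\<in>{0..1}. seller_payoff p xhat x y q \<le> seller_payoff p xhat x y (d (x, y))) \<and>
         (y * p x = y * p xhat \<longrightarrow> d (x, y) = 1)) \<and>
      (prob_nondisclosure M d > 0 \<longrightarrow> xhat = mean_nondisclosure M d))"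

end

(* With c = y (p x - p xhat), the payoff from disclosing with probability q is affine in q with slope c,
   and c has the sign of (x - xhat) y because p is strictly increasing.  So equilibria are exactly
   the threshold strategies whose threshold is the nondisclosure mean.  Such a threshold is a zero
   of a |-> E[(x - a) 1{(x - a) y < 0}]; the integrand is 1-Lipschitz in a even though the
   nondisclosure event jumps, and the expectation is nonnegative at xmin and nonpositive at xmax,
   so the intermediate value theorem applies.  Full support makes every nonempty nondisclosure
   region, being relatively open, an event of positive probability. *)

theory Submission
  imports Defs
begin

section \<open>Conditional means, best responses and the threshold integrand\<close>

text \<open>The uniform measure on \<open>S\<close> has density
  \<open>indicator S / measure M S\<close>; finite positive mass lets the extended-real division be
  replaced by the real one.\<close>

lemma integral_uniform_measure:
  fixes f :: "'a \<Rightarrow> real"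
  assumes [measurable]: "f \<in> borel_measurable M" "S \<in> sets M"
    and "emeasure M S < \<infinity>" "measure M S > 0"
  shows "(\<integral>z. f z \<partial>uniform_measure M S) = (\<integral>z. f z * indicator S z \<partial>M) / measure M S"
proof -
  have "uniform_measure M S = density M (\<lambda>z. ennreal (indicator S z / measure M S))"
    unfolding uniform_measure_def using assms(3,4)
    by (intro density_cong)
      (auto simp: indicator_def emeasure_eq_ennreal_measure divide_ennreal[symmetric] top.not_eq_extremum)
  then have "(\<integral>z. f z \<partial>uniform_measure M S) = (\<integral>z. (indicator S z / measure M S) * f z \<partial>M)"
    by (simp add: integral_density)
  also have "\<dots> = (\<integral>z. f z * indicator S z / measure M S \<partial>M)"
    by (intro Bochner_Integration.integral_cong) auto
  finally show ?thesis by simp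
qed

text \<open>A negative slope \<open>c\<close> forces \<open>q = 0\<close> and a positive one forces
  \<open>q = 1\<close>. At \<open>c = 0\<close> every \<open>q\<close> is optimal and the
  tie-breaking clause selects \<open>q = 1\<close>, which is why the inequality on the right is
  weak.\<close>

lemma best_response_iff:
  assumes p: "strict_mono_on X p" and "x \<in> X" "xhat \<in> X" and q: "q \<in> {0..1}"
  shows "(\<forall>r\<in>{0..1}. seller_payoff p xhat x y r \<le> seller_payoff p xhat x y q) \<and>
      (y * p x = y * p xhat \<longrightarrow> q = 1) \<longleftrightarrow>
    q = (if (x - xhat) * y \<ge> 0 then 1 else 0)"
proof -
  define c where "c = y * (p x - p xhat)"
  have payoff: "seller_payoff p xhat x y r = y * p xhat + r * c" for r
    by (simp add: seller_payoff_def c_def algebra_simps)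
  have "x < xhat \<longleftrightarrow> p x < p xhat" "xhat < x \<longleftrightarrow> p xhat < p x"
    using p assms(2,3) by (metis linorder_neqE_linordered_idom order_less_asym strict_mono_onD)+
  then have sign: "c < 0 \<longleftrightarrow> (x - xhat) * y < 0" and tie: "y * p x = y * p xhat \<longleftrightarrow> c = 0"
    unfolding c_def by (simp_all add: mult_less_0_iff) (auto simp: algebra_simps)
  consider "c < 0" | "c = 0" | "c > 0" by linarith
  then show ?thesis
  proof cases
    case 1
    \<comment> \<open>The single deviation \<open>r = 0\<close> suffices: it gives
      \<open>0 \<le> q * c\<close>, hence \<open>q \<le> 0\<close>.\<close>
    have "(\<forall>r\<in>{0..1}. r * c \<le> q * c) \<longleftrightarrow> q = 0"
      using 1 q by (auto simp: mult_le_cancel_right dest!: bspec[of _ _ 0])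
    with 1 sign show ?thesis unfolding payoff tie by auto
  next
    case 2
    with sign show ?thesis unfolding payoff tie by auto
  next
    case 3
    have "(\<forall>r\<in>{0..1}. r * c \<le> q * c) \<longleftrightarrow> q = 1"
      using 3 q by (auto simp: mult_le_cancel_right dest!: bspec[of _ _ 1])
    with 3 sign show ?thesis unfolding payoff tie by auto
  qed
qed

text \<open>Splitting on the sign of y, which does not involve \<open>a\<close>, leaves only
  \<open>min\<close> and \<open>max\<close> of \<open>x - a\<close> with 0, so continuity in
  \<open>a\<close> is visible: the indicator jumps where its factor \<open>x - a\<close>
  vanishes.\<close>

definition threshold_gap :: "real \<Rightarrow> real \<times> real \<Rightarrow> real" where
  "threshold_gap a z =
     (if snd z > 0 then min (fst z - a) 0 else if snd z < 0 then max (fst z - a) 0 else 0)"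

lemma threshold_gap_eq: "threshold_gap a z = (fst z - a) * of_bool ((fst z - a) * snd z < 0)"
  by (auto simp: threshold_gap_def mult_less_0_iff)

lemma threshold_gap_Lipschitz: "\<bar>threshold_gap a z - threshold_gap b z\<bar> \<le> \<bar>a - b\<bar>"
  by (auto simp: threshold_gap_def)

section \<open>The joint law and the mass of nondisclosure regions\<close>

context disclosure_environment
begin

abbreviation (input) "SX \<equiv> restrict_space borel {xmin..xmax} :: real measure"
abbreviation (input) "SY \<equiv> restrict_space borel {ymin..ymax} :: real measure"
abbreviation "law \<equiv> joint_law xmin xmax ymin ymax FY FX"
abbreviation "concealed a \<equiv> {(x, y) \<in> {xmin..xmax} \<times> {ymin..ymax}. (x - a) * y < 0}"

lemma FX_subprob [measurable]: "FX \<in> SY \<rightarrow>\<^sub>M subprob_algebra SX"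
  using FX_kernel by (rule measurable_prob_algebraD)

lemma sets_FY: "sets FY = sets SY" and space_FY: "space FY = {ymin..ymax}"
  using FY_prob sets_eq_imp_space_eq[of FY SY] by (auto simp: space_prob_algebra space_restrict_space)

lemma FX_apply:
  assumes "y \<in> {ymin..ymax}"
  shows "sets (FX y) = sets SX" "space (FX y) = {xmin..xmax}"
proof -
  have "FX y \<in> space (prob_algebra SX)"
    using measurable_space[OF FX_kernel] assms by (simp add: space_restrict_space)
  then show "sets (FX y) = sets SX" "space (FX y) = {xmin..xmax}"
    using sets_eq_imp_space_eq[of "FX y" SX] by (auto simp: space_prob_algebra space_restrict_space)
qed

lemma law_kernel:
  "(\<lambda>y. FX y \<bind> (\<lambda>x. return (SX \<Otimes>\<^sub>M SY) (x, y))) \<in> SY \<rightarrow>\<^sub>M prob_algebra (SX \<Otimes>\<^sub>M SY)"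
  by (rule measurable_bind_prob_space2[OF FX_kernel]) measurable

lemma law_prob_algebra: "law \<in> space (prob_algebra (SX \<Otimes>\<^sub>M SY))"
proof -
  \<comment> \<open>\<open>FY\<close> is viewed as a kernel from a one-point space, so that
    composition of Markov kernels applies.\<close>
  have "(\<lambda>_. FY) \<in> count_space {()} \<rightarrow>\<^sub>M prob_algebra SY"
    using FY_prob by simp
  from measurable_bind_prob_space[OF this law_kernel]
  show ?thesis unfolding joint_law_def by (auto dest: measurable_space)
qed

lemma sets_law [measurable_cong]: "sets law = sets (SX \<Otimes>\<^sub>M SY)"
  and prob_space_law: "prob_space law"
  using law_prob_algebra by (auto simp: space_prob_algebra)

lemma space_law: "space law = {xmin..xmax} \<times> {ymin..ymax}"
  using sets_eq_imp_space_eq[OF sets_law] by (simp add: space_pair_measure space_restrict_space)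

lemma law_measurable [measurable]:
  "fst \<in> borel_measurable law" "snd \<in> borel_measurable law"
proof -
  have "fst \<in> law \<rightarrow>\<^sub>M SX" "snd \<in> law \<rightarrow>\<^sub>M SY"
    by measurable
  then show "fst \<in> borel_measurable law" "snd \<in> borel_measurable law"
    by (auto simp: measurable_restrict_space2_iff)
qed

lemma concealed_sets [measurable]: "concealed a \<in> sets law"
proof -
  have "{z \<in> space law. (fst z - a) * snd z < 0} \<in> sets law" by measurable
  also have "{z \<in> space law. (fst z - a) * snd z < 0} = concealed a"
    by (auto simp: space_law)
  finally show ?thesis .
qed

text \<open>For fixed y the inner kernel is \<open>FX y\<close> paired with a point mass at y, so a
  rectangle gets mass \<open>emeasure (FX y) U\<close> if y lies in \<open>V\<close> and 0
  otherwise; \<open>FY\<close> then averages this.\<close>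

lemma emeasure_law_rectangle:
  assumes U: "U \<in> sets SX" and V: "V \<in> sets SY"
  shows "emeasure law (U \<times> V) = (\<integral>\<^sup>+y. emeasure (FX y) U * indicator V y \<partial>FY)"
proof -
  have UV [measurable]: "U \<times> V \<in> sets (SX \<Otimes>\<^sub>M SY)" using U V by simp
  have "emeasure (FX y \<bind> (\<lambda>x. return (SX \<Otimes>\<^sub>M SY) (x, y))) (U \<times> V) = emeasure (FX y) U * indicator V y"
    if y: "y \<in> {ymin..ymax}" for y
  proof -
    note FX = FX_apply[OF y]
    have "(\<lambda>x. (x, y)) \<in> SX \<rightarrow>\<^sub>M SX \<Otimes>\<^sub>M SY"
      using y by (intro measurable_Pair2') (simp add: space_restrict_space)
    then have kernel: "(\<lambda>x. return (SX \<Otimes>\<^sub>M SY) (x, y)) \<in> FX y \<rightarrow>\<^sub>M subprob_algebra (SX \<Otimes>\<^sub>M SY)"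
      unfolding measurable_cong_sets[OF FX(1) refl]
      by (rule measurable_compose) (rule return_measurable)
    have "emeasure (FX y \<bind> (\<lambda>x. return (SX \<Otimes>\<^sub>M SY) (x, y))) (U \<times> V)
      = (\<integral>\<^sup>+x. emeasure (return (SX \<Otimes>\<^sub>M SY) (x, y)) (U \<times> V) \<partial>FX y)"
      \<comment> \<open>\<open>emeasure_bind\<close> asks for a nonempty space, here the interval of
        signals.\<close>
      using x_nondegenerate by (intro emeasure_bind[OF _ kernel UV]) (simp add: FX(2))
    also have "\<dots> = (\<integral>\<^sup>+x. indicator U x * indicator V y \<partial>FX y)"
      using UV by (intro nn_integral_cong) (auto simp: indicator_def)
    also have "\<dots> = emeasure (FX y) U * indicator V y"
      using U unfolding FX(1)[symmetric] by (simp add: nn_integral_multc)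
    finally show ?thesis .
  qed
  moreover have "(\<lambda>y. FX y \<bind> (\<lambda>x. return (SX \<Otimes>\<^sub>M SY) (x, y))) \<in> FY \<rightarrow>\<^sub>M subprob_algebra (SX \<Otimes>\<^sub>M SY)"
    using measurable_prob_algebraD[OF law_kernel] by (simp add: measurable_cong_sets[OF sets_FY refl])
  ultimately show ?thesis unfolding joint_law_def
    using y_nondegenerate
    by (subst emeasure_bind[OF _ _ UV]) (auto simp: space_FY intro!: nn_integral_cong)
qed

text \<open>If the rectangle were null, the integrand over \<open>FY\<close> would vanish almost
  everywhere. Its first factor is positive for every y by full support of \<open>FX y\<close>, so
  the y-side would be \<open>FY\<close>-null, against full support of \<open>FY\<close>.\<close>

lemma emeasure_law_rectangle_pos:
  assumes "open U" "open V" "U \<inter> {xmin..xmax} \<noteq> {}" "V \<inter> {ymin..ymax} \<noteq> {}"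
  shows "emeasure law ((U \<inter> {xmin..xmax}) \<times> (V \<inter> {ymin..ymax})) > 0"
proof (rule ccontr)
  let ?U = "U \<inter> {xmin..xmax}" and ?V = "V \<inter> {ymin..ymax}"
  assume "\<not> ?thesis"
  moreover have U: "?U \<in> sets SX" and V [measurable]: "?V \<in> sets FY"
    using assms(1,2) by (simp_all add: sets_FY sets_restrict_space_iff)
  ultimately have "(\<integral>\<^sup>+y. emeasure (FX y) ?U * indicator ?V y \<partial>FY) = 0"
    by (simp add: emeasure_law_rectangle sets_FY)
  moreover have "(\<lambda>y. emeasure (FX y) ?U) \<in> borel_measurable FY"
    using measurable_compose[OF FX_subprob measurable_emeasure_subprob_algebra[OF U]]
    by (simp add: measurable_cong_sets[OF sets_FY refl])
  ultimately have "AE y in FY. emeasure (FX y) ?U * indicator ?V y = 0"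
    by (subst (asm) nn_integral_0_iff_AE) auto
  then have "AE y in FY. y \<notin> ?V"
  proof (rule AE_mp, intro AE_I2 impI)
    fix y assume "y \<in> space FY" and 0: "emeasure (FX y) ?U * indicator ?V y = 0"
    then have "emeasure (FX y) ?U > 0"
      using FX_full_support[of y] assms(1,3) by (auto simp: space_FY full_support_on_def)
    with 0 show "y \<notin> ?V" by (auto simp: indicator_def)
  qed
  then have "emeasure FY ?V = 0"
    using V by (subst (asm) AE_iff_measurable[OF V]) (auto simp: space_FY)
  with FY_full_support assms(2,4) show False by (auto simp: full_support_on_def)
qed

text \<open>A point of the region has an open box inside the open set \<open>?O\<close>. The trace
  of this box on the type space has positive mass, even when the point lies on the boundary of the
  type space.\<close>

lemma measure_concealed_pos:
  assumes "concealed a \<noteq> {}"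
  shows "measure law (concealed a) > 0"
proof -
  interpret prob_space law by (fact prob_space_law)
  let ?O = "{z :: real \<times> real. (fst z - a) * snd z < 0}"
  obtain x y where xy: "(x, y) \<in> ?O" "x \<in> {xmin..xmax}" "y \<in> {ymin..ymax}" using assms by auto
  have "open ?O" by (intro open_Collect_less continuous_intros)
  then obtain U V where UV: "open U" "open V" "(x, y) \<in> U \<times> V" "U \<times> V \<subseteq> ?O"
    using xy(1) by (rule open_prod_elim)
  have "0 < emeasure law ((U \<inter> {xmin..xmax}) \<times> (V \<inter> {ymin..ymax}))"
    using UV xy by (intro emeasure_law_rectangle_pos) auto
  also have "\<dots> \<le> emeasure law (concealed a)"
    using UV(4) by (intro emeasure_mono concealed_sets) auto
  finally show ?thesis by (simp add: emeasure_eq_measure)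
qed

section \<open>Existence of a self-consistent threshold\<close>

lemma integrable_law_bounded:
  fixes f :: "real \<times> real \<Rightarrow> real"
  assumes "f \<in> borel_measurable law" "\<And>z. z \<in> space law \<Longrightarrow> \<bar>f z\<bar> \<le> B"
  shows "integrable law f"
proof -
  interpret prob_space law by (fact prob_space_law)
  show ?thesis using assms by (intro integrable_const_bound[where B = B]) auto
qed

lemma integrable_fst_concealed: "integrable law (\<lambda>z. fst z * indicator (concealed a) z)"
  by (rule integrable_law_bounded[where B = "\<bar>xmin\<bar> + \<bar>xmax\<bar>"])
    (auto simp: space_law indicator_def)

lemma threshold_gap_measurable [measurable]: "threshold_gap a \<in> borel_measurable law"
  unfolding threshold_gap_def by measurable

lemma integrable_threshold_gap: "integrable law (threshold_gap a)"
  by (rule integrable_law_bounded[where B = "\<bar>xmin\<bar> + \<bar>xmax\<bar> + \<bar>a\<bar>"])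
    (auto simp: space_law threshold_gap_def)

text \<open>Zeros of the expected gap are thus the solutions of the Bayes condition in product form,
  which needs no division and also makes sense when the region is null.\<close>

lemma integral_threshold_gap:
  "(\<integral>z. threshold_gap a z \<partial>law) =
     (\<integral>z. fst z * indicator (concealed a) z \<partial>law) - a * measure law (concealed a)"
proof -
  interpret prob_space law by (fact prob_space_law)
  have "(\<integral>z. threshold_gap a z \<partial>law) =
      (\<integral>z. fst z * indicator (concealed a) z - a * indicator (concealed a) z \<partial>law)"
    by (intro Bochner_Integration.integral_cong)
      (auto simp: threshold_gap_eq space_law indicator_def algebra_simps)
  also have "\<dots> = (\<integral>z. fst z * indicator (concealed a) z \<partial>law) - (\<integral>z. a * indicator (concealed a) z \<partial>law)"
    by (intro Bochner_Integration.integral_diff integrable_fst_concealed integrable_mult_right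
        integrable_real_indicator concealed_sets) (simp add: emeasure_eq_measure)
  finally show ?thesis
    by (simp only: integral_mult_right_zero Bochner_Integration.integral_indicator Int_absorb2[OF sets.sets_into_space[OF concealed_sets]])
qed

lemma fixed_threshold_exists:
  obtains a where "a \<in> {xmin..xmax}"
    "(\<integral>z. fst z * indicator (concealed a) z \<partial>law) = a * measure law (concealed a)"
proof -
  interpret prob_space law by (fact prob_space_law)
  let ?G = "\<lambda>a. \<integral>z. threshold_gap a z \<partial>law"
  have "\<bar>?G a - ?G b\<bar> \<le> \<bar>a - b\<bar>" for a b
  proof -
    have "\<bar>?G a - ?G b\<bar> = \<bar>\<integral>z. threshold_gap a z - threshold_gap b z \<partial>law\<bar>"
      by (simp add: integrable_threshold_gap)
    also have "\<dots> \<le> (\<integral>z. \<bar>threshold_gap a z - threshold_gap b z\<bar> \<partial>law)"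
      by (rule integral_abs_bound)
    also have "\<dots> \<le> (\<integral>z. \<bar>a - b\<bar> \<partial>law)"
      by (intro integral_mono integrable_abs Bochner_Integration.integrable_diff
          integrable_threshold_gap threshold_gap_Lipschitz) auto
    finally show ?thesis by (simp add: prob_space)
  qed
  then have "1-lipschitz_on UNIV ?G" by (auto simp: lipschitz_on_def dist_real_def)
  then have "continuous_on {xmin..xmax} ?G"
    by (intro lipschitz_on_continuous_on) (rule lipschitz_on_subset, auto)
  \<comment> \<open>At \<open>a = xmin\<close> every signal has \<open>x - a \<ge> 0\<close>, so the
    \<open>min\<close> branch vanishes and the \<open>max\<close> branch is nonnegative; at
    \<open>xmax\<close> the roles are reversed.\<close>
  moreover have "?G xmin \<ge> 0"
    by (rule Bochner_Integration.integral_nonneg) (auto simp: threshold_gap_def space_law)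
  moreover have "?G xmax \<le> (\<integral>z. 0 \<partial>law)"
    by (intro integral_mono integrable_threshold_gap) (auto simp: threshold_gap_def space_law)
  ultimately obtain a where "a \<in> {xmin..xmax}" "?G a = 0"
    using IVT2'[of ?G xmax 0 xmin] x_nondegenerate by auto
  then show thesis using that integral_threshold_gap[of a] by auto
qed

section \<open>Characterization of equilibria\<close>

text \<open>The posterior after nondisclosure is itself the threshold. Optimality with tie-breaking
  reduces pointwise to the threshold rule; under that rule \<open>d\<close> is measurable and
  \<open>1 - d\<close> is the indicator of \<open>concealed a\<close>, which turns the Bayes clause
  into a quotient of integrals.\<close>

lemma equilibrium_iff:
  assumes "demand_function xmin xmax p"
  shows "disclosure_equilibrium xmin xmax ymin ymax FY FX p d a \<longleftrightarrow>
    a \<in> {xmin..xmax} \<and>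
    (\<forall>x\<in>{xmin..xmax}. \<forall>y\<in>{ymin..ymax}. d (x, y) = (if (x - a) * y \<ge> 0 then 1 else 0)) \<and>
    (measure law (concealed a) > 0 \<longrightarrow>
       a = (\<integral>z. fst z * indicator (concealed a) z \<partial>law) / measure law (concealed a))"
    (is "?E \<longleftrightarrow> ?A \<and> ?T \<and> ?B")
proof -
  interpret prob_space law by (fact prob_space_law)
  have p: "strict_mono_on {xmin..xmax} p" using assms by (simp add: demand_function_def)
  \<comment> \<open>The restriction to \<open>?A\<close> is there because \<open>p\<close> is known
    to be strictly increasing only on the signal interval, which must contain
    \<open>a\<close>.\<close>
  have T: "?T \<longleftrightarrow> (\<forall>x\<in>{xmin..xmax}. \<forall>y\<in>{ymin..ymax}. d (x, y) \<in> {0..1}) \<and>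
      (\<forall>x\<in>{xmin..xmax}. \<forall>y\<in>{ymin..ymax}.
         (\<forall>q\<in>{0..1}. seller_payoff p a x y q \<le> seller_payoff p a x y (d (x, y))) \<and>
         (y * p x = y * p a \<longrightarrow> d (x, y) = 1))" (is "_ \<longleftrightarrow> ?R \<and> ?O") if ?A
  proof -
    have "?T \<Longrightarrow> ?R" by auto
    moreover have "?R \<Longrightarrow> ?T \<longleftrightarrow> ?O"
      using best_response_iff[OF p _ that] by (intro ball_cong refl) blast
    ultimately show ?thesis by blast
  qed
  have d: "d \<in> borel_measurable law" "prob_nondisclosure law d = measure law (concealed a)"
    "mean_nondisclosure law d =
      (\<integral>z. fst z * indicator (concealed a) z \<partial>law) / measure law (concealed a)" if ?T
  proof -
    have eq: "1 - d z = indicator (concealed a) z" if "z \<in> space law" for z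
      using that \<open>?T\<close> by (cases z) (auto simp: space_law indicator_def)
    then have eq': "d z = 1 - indicator (concealed a) z" if "z \<in> space law" for z
      using eq[OF that] by linarith
    have "(\<lambda>z. 1 - indicator (concealed a) z :: real) \<in> borel_measurable law" by measurable
    then show "d \<in> borel_measurable law"
      by (subst measurable_cong[OF eq'])
    show prob: "prob_nondisclosure law d = measure law (concealed a)"
      unfolding prob_nondisclosure_def
      by (subst Bochner_Integration.integral_cong[OF refl eq])
        (simp_all only: Bochner_Integration.integral_indicator Int_absorb2[OF sets.sets_into_space[OF concealed_sets]])
    show "mean_nondisclosure law d =
        (\<integral>z. fst z * indicator (concealed a) z \<partial>law) / measure law (concealed a)"
      unfolding mean_nondisclosure_def prob
      by (simp add: eq cong: Bochner_Integration.integral_cong)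
  qed
  \<comment> \<open>Propositional glue: measurability \<open>B\<close> follows from the threshold
    rule \<open>T\<close>, and the Bayes clause \<open>C\<close> is rewritten only under
    \<open>T\<close>.\<close>
  have reorder: "B \<and> R \<and> A \<and> Q \<and> C \<longleftrightarrow> A \<and> T \<and> C'"
    if "A \<Longrightarrow> T \<longleftrightarrow> R \<and> Q" "T \<Longrightarrow> B" "T \<Longrightarrow> C \<longleftrightarrow> C'" for A B C C' Q R T
    using that by blast
  show ?thesis
    unfolding disclosure_equilibrium_def Let_def
    by (rule reorder[OF T d(1)]) (simp_all only: d(2,3))
qed

end

theorem proposition6:
  fixes xmin xmax ymin ymax :: real
    and FY :: "real measure" and FX :: "real \<Rightarrow> real measure" and p :: "real \<Rightarrow> real"
  assumes "disclosure_environment xmin xmax ymin ymax FY FX"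
    and "demand_function xmin xmax p"
  shows "(\<exists>d xhat. disclosure_equilibrium xmin xmax ymin ymax FY FX p d xhat) \<and>
    (\<forall>d xhat. disclosure_equilibrium xmin xmax ymin ymax FY FX p d xhat \<longrightarrow>
      (\<exists>xbar\<in>{xmin..xmax}.
        (\<forall>x\<in>{xmin..xmax}. \<forall>y\<in>{ymin..ymax}.
           d (x, y) \<in> {0, 1} \<and> (d (x, y) = 1 \<longleftrightarrow> (x - xbar) * y \<ge> 0)) \<and>
        (let M = joint_law xmin xmax ymin ymax FY FX;
             N = {(x, y) \<in> {xmin..xmax} \<times> {ymin..ymax}. (x - xbar) * y < 0}
         in N \<noteq> {} \<longrightarrow> measure M N > 0 \<and> xbar = (\<integral>z. fst z \<partial>uniform_measure M N))))"
proof -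
  interpret disclosure_environment xmin xmax ymin ymax FY FX by (fact assms(1))
  interpret prob_space law by (fact prob_space_law)
  note eq_iff = equilibrium_iff[OF assms(2)]
  have "\<exists>d a. disclosure_equilibrium xmin xmax ymin ymax FY FX p d a"
  proof -
    obtain a where "a \<in> {xmin..xmax}"
      "(\<integral>z. fst z * indicator (concealed a) z \<partial>law) = a * measure law (concealed a)"
      by (rule fixed_threshold_exists)
    then have "disclosure_equilibrium xmin xmax ymin ymax FY FX p
        (\<lambda>(x, y). if (x - a) * y \<ge> 0 then 1 else 0) a"
      unfolding eq_iff by auto
    then show ?thesis by blast
  qed
  moreover have "\<exists>a\<in>{xmin..xmax}.
      (\<forall>x\<in>{xmin..xmax}. \<forall>y\<in>{ymin..ymax}.
         d (x, y) \<in> {0, 1} \<and> (d (x, y) = 1 \<longleftrightarrow> (x - a) * y \<ge> 0)) \<and>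
      (concealed a \<noteq> {} \<longrightarrow> measure law (concealed a) > 0 \<and>
         a = (\<integral>z. fst z \<partial>uniform_measure law (concealed a)))"
    if eq: "disclosure_equilibrium xmin xmax ymin ymax FY FX p d a" for d a
  \<comment> \<open>The witness for the threshold is the equilibrium posterior itself.\<close>
  proof (intro bexI[of _ a] conjI impI)
    note threshold = eq[unfolded eq_iff]
    show "a \<in> {xmin..xmax}" using threshold by (rule conjunct1)
    show "\<forall>x\<in>{xmin..xmax}. \<forall>y\<in>{ymin..ymax}.
        d (x, y) \<in> {0, 1} \<and> (d (x, y) = 1 \<longleftrightarrow> (x - a) * y \<ge> 0)"
      using threshold by (elim conjE) simp
    assume "concealed a \<noteq> {}"
    \<comment> \<open>Positive mass activates the Bayes clause and makes
      \<open>uniform_measure\<close> the genuine conditional law given nondisclosure.\<close>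
    then show pos: "measure law (concealed a) > 0" by (rule measure_concealed_pos)
    then have "a = (\<integral>z. fst z * indicator (concealed a) z \<partial>law) / measure law (concealed a)"
      using threshold by (elim conjE) (erule mp)
    with pos show "a = (\<integral>z. fst z \<partial>uniform_measure law (concealed a))"
      by (subst integral_uniform_measure[OF law_measurable(1) concealed_sets])
        (simp_all only: emeasure_eq_measure ennreal_less_top infinity_ennreal_def)
  qed
  ultimately show ?thesis
    unfolding Let_def by (intro conjI allI impI)
qed

end
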